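(* A binary word $w$ has balanced borders if and only if for all $n,j\in\mathbb{N}$, $$|\Omega_{n,j}^w| = |\Omega_{n,n-j}^w| \quad\text{and}\quad \mathbb{P}(\tau^w = n,\ N(\tau^w) = j) = \mathbb{P}(\tau^w = n,\ N(\tau^w) = n-j).$$ In particular, if $w$ has balanced borders, then $\rho^w = q^w = \frac12$.
   Context: A word is an element of $\{0,1\}^k$ for some integer $k \ge 1$. For a word $\omega$, $|\omega|$ is its length, $|\omega|_1$ its number of $1$s, and $\omega_{[a,b]}=(\omega_a,\dots,\omega_b)$. $\mathcal{B}(w,w)=\{w_{[1,j]} : 1\le j\le|w|,\ w_{[1,j]}=w_{[|w|-j+1,|w|]}\}$ is the set of borders of $w$ (including $w$ itself). The word $w$ has balanced borders if $|b| = 2|b|_1$ for all $b\in\mathcal{B}(w,w)$. For $n\ge1$, $\Omega_n^w$ is the set of words in $\{0,1\}^n$ that do not contain $w$ as a factor (contiguous subword), and $\Omega_{n,j}^w=\{\omega\in\Omega_n^w : |\omega|_1=j\}$ (empty if $j<0$ or $j>n$). Letter frequency: $\rho_n^w = \frac{1}{n|\Omega_n^w|}\sum_{\omega\in\Omega_n^w}|\omega|_1$ and $\rho^w=\lim_{n\to\infty}\rho_n^w$ (this limit always exists). Let $(X_n)_{n\ge1}$ be i.i.d. Bernoulli$(1/2)$ random variables with law $\mathbb{P}$ and expectation $\mathbb{E}$. For a word $w$ of length $k$, $\tau^w=\min\{t\ge1:(X_{t-k+1},\dots,X_t)=w\}$ (first time at which $w$ has occurred; necessarily $\tau^w\ge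 k$). Let $N(t)=\sum_{s=1}^tX_s$, $Q(t)=N(t)/t$, and $q^w=\mathbb{E}[Q(\tau^w)]$. *)

theory Defs
  imports "HOL-Probability.Probability" "HOL-Library.Sublist" "HOL-Library.Extended_Nat"
begin

text \<open>Binary words are lists of type \<^typ>\<open>bool list\<close>, with \<^const>\<open>True\<close> as the letter 1 and
  \<^const>\<open>False\<close> as the letter 0.\<close>

abbreviation ones :: "bool list \<Rightarrow> nat" where
  "ones u \<equiv> count_list u True"

definition borders :: "bool list \<Rightarrow> bool list set" where
  "borders w = {take j w | j. 1 \<le> j \<and> j \<le> length w \<and> take j w = drop (length w - j) w}"

definition balanced_borders :: "bool list \<Rightarrow> bool" where
  "balanced_borders w \<longleftrightarrow> (\<forall>b \<in> borders w. length b = 2 * ones b)"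

definition avoiding :: "bool list \<Rightarrow> nat \<Rightarrow> bool list set" where
  "avoiding w n = {u. length u = n \<and> \<not> sublist w u}"

text \<open>The number of ones is prescribed by an integer, so that \<open>n - j\<close> is a true subtraction and
  the set is empty for \<open>j < 0\<close> and for \<open>j > n\<close>.\<close>

definition avoiding_ones :: "bool list \<Rightarrow> nat \<Rightarrow> int \<Rightarrow> bool list set" where
  "avoiding_ones w n j = {u \<in> avoiding w n. int (ones u) = j}"

definition letter_freq_at :: "bool list \<Rightarrow> nat \<Rightarrow> real" where
  "letter_freq_at w n =
     1 / (real n * real (card (avoiding w n))) * (\<Sum>u\<in>avoiding w n. real (ones u))"

definition letter_freq :: "bool list \<Rightarrow> real" where
  "letter_freq w = lim (letter_freq_at w)"

text \<open>A sequence of letters is indexed from 1; the value at index 0 is never used.\<close>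

definition num_ones :: "(nat \<Rightarrow> 'a \<Rightarrow> bool) \<Rightarrow> nat \<Rightarrow> 'a \<Rightarrow> nat" where
  "num_ones X t x = (\<Sum>s = 1..t. of_bool (X s x))"

definition prop_ones :: "(nat \<Rightarrow> 'a \<Rightarrow> bool) \<Rightarrow> nat \<Rightarrow> 'a \<Rightarrow> real" where
  "prop_ones X t x = real (num_ones X t x) / real t"

text \<open>The hitting time is infinite if \<open>w\<close> never occurs. The condition \<^term>\<open>length w \<le> t\<close>
  keeps all indices in the window \<open>t - length w + 1, \<dots>, t\<close> positive despite truncated
  subtraction.\<close>

definition hitting_time :: "(nat \<Rightarrow> 'a \<Rightarrow> bool) \<Rightarrow> bool list \<Rightarrow> 'a \<Rightarrow> enat" where
  "hitting_time X w x =
     Inf {enat t | t. 1 \<le> t \<and> length w \<le> t \<and>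
                     map (\<lambda>s. X s x) [t - length w + 1..<t + 1] = w}"

definition prob_hit :: "'a measure \<Rightarrow> (nat \<Rightarrow> 'a \<Rightarrow> bool) \<Rightarrow> bool list \<Rightarrow> nat \<Rightarrow> int \<Rightarrow> real" where
  "prob_hit M X w n j =
     measure M {x \<in> space M. hitting_time X w x = enat n \<and>
                             int (num_ones X (the_enat (hitting_time X w x)) x) = j}"

text \<open>The hitting time of a nonempty word is almost surely finite under fair coin tosses; the value
  0 on the null event where it is infinite is immaterial.\<close>

definition mean_prop_hit :: "'a measure \<Rightarrow> (nat \<Rightarrow> 'a \<Rightarrow> bool) \<Rightarrow> bool list \<Rightarrow> real" where
  "mean_prop_hit M X w =
     (LINT x|M. (case hitting_time X w x of enat t \<Rightarrow> prop_ones X t x | \<infinity> \<Rightarrow> 0))"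

end

theory Submission
  imports Defs
begin

text \<open>Let \<open>s(n, j)\<close> count the words of length \<open>n\<close> with \<open>j\<close> ones that avoid \<open>w\<close>, and let \<open>t(n, j)\<close>
  count those in which \<open>w\<close> occurs exactly once, at the end, so that the hitting probability is
  \<open>t(n, j) / 2\<^sup>n\<close>. Appending one letter to an avoiding word gives
  \<open>s(n + 1, j) + t(n + 1, j) = s(n, j) + s(n, j - 1)\<close>, and appending \<open>w\<close> itself gives
  \<open>s(n, j) = (\<Sum>b. t(n + |b|, j + |b|\<^sub>1))\<close> over the borders \<open>b\<close> of \<open>w\<close>. If all borders are balanced,
  these two recurrences are compatible with \<open>j \<mapsto> n - j\<close>, and symmetry follows by induction on
  \<open>n\<close>. Conversely, symmetry of \<open>t(|w|, \<cdot>)\<close> shows that \<open>w\<close> is balanced, and the second recurrence at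
  \<open>n = |w| - |b|\<close> transfers balance from the longer borders to \<open>b\<close>.\<close>

section \<open>Borders and first-hit words\<close>

text \<open>A border is determined by its length, so sums over borders become sums over a finite set
  of numbers.\<close>

definition border_lengths :: "bool list \<Rightarrow> nat set" where
  "border_lengths w = {l. 1 \<le> l \<and> l \<le> length w \<and> take l w = drop (length w - l) w}"

text \<open>The set counted by t(n, j): for nonempty \<open>w\<close>, an occurrence that is not at
  the end lies in \<open>butlast u\<close>.\<close>

definition first_hits :: "bool list \<Rightarrow> nat \<Rightarrow> int \<Rightarrow> bool list set" where
  "first_hits w n j =
     {u. length u = n \<and> suffix w u \<and> \<not> sublist w (butlast u) \<and> int (ones u) = j}"

lemma finite_border_lengths [simp]: "finite (border_lengths w)"
  by (rule finite_subset[of _ "{..length w}"]) (auto simp: border_lengths_def)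

lemma finite_lists_of_length: "finite {u :: bool list. length u = n \<and> P u}"
  by (rule finite_subset[OF _ finite_lists_length_eq[of "UNIV :: bool set" n]]) auto

lemma finite_avoiding [simp]: "finite (avoiding w n)"
  unfolding avoiding_def by (rule finite_lists_of_length)

lemma finite_avoiding_ones [simp]: "finite (avoiding_ones w n j)"
  unfolding avoiding_ones_def by simp

lemma finite_first_hits [simp]: "finite (first_hits w n j)"
  unfolding first_hits_def by (rule finite_lists_of_length)

lemma length_first_hits: "u \<in> first_hits w n j \<Longrightarrow> length u = n"
  by (simp add: first_hits_def)

lemma balanced_borders_iff:
  "balanced_borders w \<longleftrightarrow> (\<forall>l\<in>border_lengths w. l = 2 * ones (take l w))"
proof -
  have "borders w = (\<lambda>l. take l w) ` border_lengths w"
    unfolding borders_def border_lengths_def by blast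
  moreover have "length (take l w) = l" if "l \<in> border_lengths w" for l
    using that by (simp add: border_lengths_def)
  ultimately show ?thesis unfolding balanced_borders_def by simp
qed

lemma length_in_border_lengths: "w \<noteq> [] \<Longrightarrow> length w \<in> border_lengths w"
  by (cases w) (auto simp: border_lengths_def)

text \<open>Both \<open>w\<close> and \<open>take l w\<close> are suffixes of the same word, so the
  shorter is a suffix of the longer.\<close>

lemma suffix_append_take_border:
  assumes "suffix w (u @ take l w)" "l \<le> length w"
  shows "take l w = drop (length w - l) w"
proof -
  have "suffix (take l w) w"
    by (rule suffix_length_suffix[of _ "u @ take l w"]) (use assms in \<open>auto simp: suffix_def\<close>)
  then obtain zs where "w = zs @ take l w" by (auto simp: suffix_def)
  then show ?thesis
    by (metis append_eq_conv_conj assms(2) diff_diff_cancel length_append length_take min.absorb2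
        add_diff_cancel_right')
qed

lemma suffix_drop_last:
  assumes "suffix w v" "l \<le> length w" "length v = n + l"
  shows "drop n v = drop (length w - l) w"
proof -
  obtain zs where v: "v = zs @ w" using assms(1) by (auto simp: suffix_def)
  then have "n - length zs = length w - l" "length zs \<le> n" using assms by auto
  then show ?thesis using v by simp
qed

lemma sublist_iff_suffix_take: "sublist w u \<longleftrightarrow> (\<exists>m\<le>length u. suffix w (take m u))"
proof
  assume "sublist w u"
  then obtain p where p: "prefix p u" "suffix w p" by (auto simp: sublist_altdef)
  then show "\<exists>m\<le>length u. suffix w (take m u)"
    by (intro exI[of _ "length p"]) (auto simp: prefix_def)
next
  assume "\<exists>m\<le>length u. suffix w (take m u)"
  then show "sublist w u" by (auto simp: sublist_altdef intro: take_is_prefix)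
qed

lemma prefix_take_take: "a \<le> b \<Longrightarrow> prefix (take a xs) (take b xs)"
  by (metis min.absorb1 take_is_prefix take_take)

lemma butlast_append_take:
  assumes "1 \<le> l" "l \<le> length w"
  shows "butlast (u @ take l w) = u @ take (l - 1) w"
proof -
  have "take l w \<noteq> []" using assms by auto
  then show ?thesis using assms by (simp add: butlast_append butlast_take)
qed

text \<open>The shorter word ends in \<open>w\<close> and is a prefix of the longer one without its
  last letter, which avoids \<open>w\<close>. So at most one border completes \<open>u\<close> to a
  first hit.\<close>

lemma first_hits_disjoint:
  assumes "u @ take l w \<in> first_hits w n j" "u @ take l' w \<in> first_hits w n' j'"
    "l < l'" "l' \<le> length w"
  shows False
proof -
  have "prefix (u @ take l w) (butlast (u @ take l' w))"
    using assms by (simp add: butlast_append_take prefix_take_take)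
  then show False
    using assms unfolding first_hits_def by (auto simp: sublist_altdef)
qed

text \<open>Append \<open>w\<close> to an avoiding word \<open>u\<close>: the first occurrence of \<open>w\<close> in \<open>u @ w\<close> ends inside the
  appended copy, and its overlap with that copy is a border.\<close>

lemma avoiding_obtains_first_hit:
  assumes "w \<noteq> []" "\<not> sublist w u"
  obtains l where "l \<in> border_lengths w" "suffix w (u @ take l w)"
    "\<not> sublist w (butlast (u @ take l w))"
proof -
  define l where "l = (LEAST l. suffix w (u @ take l w))"
  have ex: "suffix w (u @ take (length w) w)" by (simp add: suffix_def)
  have suf: "suffix w (u @ take l w)" unfolding l_def by (rule LeastI[of _ "length w"]) (rule ex)
  have le: "l \<le> length w" unfolding l_def by (rule Least_le) (rule ex)
  have "l \<noteq> 0" using suf assms by (auto dest: suffix_imp_sublist)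
  then have "l \<in> border_lengths w"
    using suffix_append_take_border[OF suf le] le by (auto simp: border_lengths_def)
  moreover have "\<not> sublist w (butlast (u @ take l w))"
  proof
    assume "sublist w (butlast (u @ take l w))"
    also have "butlast (u @ take l w) = u @ take (l - 1) w"
      using \<open>l \<noteq> 0\<close> le by (simp add: butlast_append_take)
    finally obtain p where p: "prefix p (u @ take (l - 1) w)" "suffix w p"
      by (auto simp: sublist_altdef)
    from p(1) show False
      unfolding prefix_append
    proof
      assume "prefix p u"
      then show False using p assms by (auto simp: sublist_altdef)
    next
      assume "\<exists>us. p = u @ us \<and> prefix us (take (l - 1) w)"
      \<comment> \<open>The occurrence ends inside the appended part after fewer than
        \<open>l\<close> letters, against the minimality of \<open>l\<close>.\<close>
      then obtain us where us: "p = u @ us" "prefix us (take (l - 1) w)" by blast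
      have "length us \<le> l - 1" using prefix_length_le[OF us(2)] le by simp
      moreover have "us = take (length us) w"
        using us(2) by (metis prefix_order.trans take_is_prefix append_eq_conv_conj prefixE)
      moreover have "l \<le> length us"
        unfolding l_def by (rule Least_le) (use p us calculation in argo)
      ultimately show False using \<open>l \<noteq> 0\<close> by simp
    qed
  qed
  ultimately show ?thesis using suf that by blast
qed

section \<open>The two recurrences\<close>

text \<open>Classify the avoiding words \<open>u\<close> by the unique border length
  \<open>l\<close> for which \<open>u @ take l w\<close> is a first hit; cutting off the last
  \<open>l\<close> letters inverts this map.\<close>

lemma card_avoiding_ones_eq_sum_first_hits:
  assumes "w \<noteq> []"
  shows "card (avoiding_ones w n j) =
    (\<Sum>l\<in>border_lengths w. card (first_hits w (n + l) (j + int (ones (take l w)))))"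
proof -
  define F where "F l = first_hits w (n + l) (j + int (ones (take l w)))" for l
  define U where "U l = {u \<in> avoiding_ones w n j. u @ take l w \<in> F l}" for l
  have "card (U l) = card (F l)" if l: "l \<in> border_lengths w" for l
  proof (rule bij_betw_same_card)
    show "bij_betw (\<lambda>u. u @ take l w) (U l) (F l)"
    proof (rule bij_betwI[where g = "take n"])
      show "take n \<in> F l \<rightarrow> U l"
      proof
        fix v assume v: "v \<in> F l"
        have "drop n v = take l w"
          using v l suffix_drop_last[of w v l n]
          by (auto simp: F_def first_hits_def border_lengths_def)
        then have eq: "take n v @ take l w = v" by (metis append_take_drop_id)
        have "ones v = ones (take n v) + ones (take l w)" by (metis eq count_list_append)
        \<comment> \<open>As \<open>l \<ge> 1\<close>, the cut removes the last letter and with it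
          the only occurrence of \<open>w\<close>.\<close>
        moreover have "prefix (take n v) (butlast v)"
          using v l by (auto simp: F_def first_hits_def border_lengths_def butlast_conv_take
              intro!: prefix_take_take)
        then have "\<not> sublist w (take n v)"
          using v by (auto simp: F_def first_hits_def sublist_altdef dest: prefix_order.trans)
        ultimately show "take n v \<in> U l"
          using v l eq
          by (auto simp: U_def F_def first_hits_def avoiding_ones_def avoiding_def border_lengths_def)
      qed
    next
      fix v assume v: "v \<in> F l"
      have "drop n v = take l w"
        using v l suffix_drop_last[of w v l n]
        by (auto simp: F_def first_hits_def border_lengths_def)
      then show "take n v @ take l w = v" by (metis append_take_drop_id)
    qed (auto simp: U_def avoiding_ones_def avoiding_def)
  qed
  moreover have "avoiding_ones w n j = (\<Union>l\<in>border_lengths w. U l)"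
  proof (intro equalityI subsetI)
    fix u assume u: "u \<in> avoiding_ones w n j"
    then have "\<not> sublist w u" by (auto simp: avoiding_ones_def avoiding_def)
    with assms obtain l where "l \<in> border_lengths w" "suffix w (u @ take l w)"
      "\<not> sublist w (butlast (u @ take l w))" by (rule avoiding_obtains_first_hit)
    with u show "u \<in> (\<Union>l\<in>border_lengths w. U l)"
      by (auto simp: U_def F_def first_hits_def avoiding_ones_def avoiding_def border_lengths_def
          intro!: bexI[of _ l])
  qed (auto simp: U_def)
  moreover have "U l \<inter> U l' = {}" if "l \<in> border_lengths w" "l' \<in> border_lengths w" "l \<noteq> l'" for l l'
  proof -
    have "l \<le> length w" "l' \<le> length w" using that by (auto simp: border_lengths_def)
    then show ?thesis
      using that(3) first_hits_disjoint[of _ l w _ _ l'] first_hits_disjoint[of _ l' w _ _ l]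
      unfolding U_def F_def by (cases l l' rule: linorder_cases) blast+
  qed
  moreover have "finite (U l)" for l unfolding U_def by simp
  ultimately show ?thesis
    by (simp add: card_UN_disjoint F_def)
qed

text \<open>Both sides count the words of length \<open>Suc n\<close> with \<open>j\<close> ones
  whose first \<open>n\<close> letters avoid \<open>w\<close>: on the left by whether
  \<open>w\<close> occurs at the end, on the right by the last letter.\<close>

lemma card_avoiding_ones_Suc:
  assumes "w \<noteq> []"
  shows "card (avoiding_ones w (Suc n) j) + card (first_hits w (Suc n) j) =
    card (avoiding_ones w n j) + card (avoiding_ones w n (j - 1))"
proof -
  let ?f = "\<lambda>b u. u @ [b]"
  have iff: "sublist w (u @ [b]) \<longleftrightarrow> suffix w (u @ [b]) \<or> sublist w u" for u b
    using assms
    by (auto simp: sublist_altdef prefix_snoc intro: suffix_order.refl)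
  have "avoiding_ones w (Suc n) j \<union> first_hits w (Suc n) j =
     ?f False ` avoiding_ones w n j \<union> ?f True ` avoiding_ones w n (j - 1)"
  proof (intro equalityI subsetI)
    fix v assume v: "v \<in> avoiding_ones w (Suc n) j \<union> first_hits w (Suc n) j"
    then obtain u b where "v = u @ [b]"
      by (cases v rule: rev_cases) (auto simp: avoiding_ones_def avoiding_def first_hits_def)
    with v show "v \<in> ?f False ` avoiding_ones w n j \<union> ?f True ` avoiding_ones w n (j - 1)"
      by (cases b) (auto simp: avoiding_ones_def avoiding_def first_hits_def iff)
  qed (auto simp: avoiding_ones_def avoiding_def first_hits_def iff)
  moreover have "avoiding_ones w (Suc n) j \<inter> first_hits w (Suc n) j = {}"
    by (auto simp: avoiding_ones_def avoiding_def first_hits_def dest: suffix_imp_sublist)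
  moreover have "?f False ` avoiding_ones w n j \<inter> ?f True ` avoiding_ones w n (j - 1) = {}"
    by auto
  ultimately show ?thesis
    by (metis (no_types, lifting) card_Un_disjoint card_image finite_avoiding_ones
        finite_first_hits finite_imageI inj_onI append1_eq_conv)
qed

lemma first_hits_short: "n < length w \<Longrightarrow> first_hits w n j = {}"
  by (auto simp: first_hits_def dest: suffix_length_le)

lemma first_hits_length:
  assumes "w \<noteq> []"
  shows "first_hits w (length w) j = (if j = int (ones w) then {w} else {})"
proof -
  have "\<not> sublist w (butlast w)" using assms by (auto dest!: sublist_length_le) (cases w; simp)
  then show ?thesis by (auto simp: first_hits_def suffix_def)
qed

lemma avoiding_ones_0: "w \<noteq> [] \<Longrightarrow> avoiding_ones w 0 j = (if j = 0 then {[]} else {})"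
  by (auto simp: avoiding_ones_def avoiding_def)

lemma avoiding_ones_empty: "j < 0 \<or> int n < j \<Longrightarrow> avoiding_ones w n j = {}"
  by (auto simp: avoiding_ones_def avoiding_def) (metis count_le_length not_less)

lemma first_hits_empty: "j < 0 \<or> int n < j \<Longrightarrow> first_hits w n j = {}"
  by (auto simp: first_hits_def) (metis count_le_length not_less)

section \<open>Balance and symmetry of the counts\<close>

text \<open>The first-hit part comes first, from the border recurrence at length
  \<open>n - length w\<close>, where only the term of \<open>w\<close> itself reaches length
  \<open>n\<close>; the avoiding part then follows from the one-letter recurrence.\<close>

lemma balanced_imp_symmetric:
  assumes "w \<noteq> []" and bal: "balanced_borders w"
  shows "card (avoiding_ones w n j) = card (avoiding_ones w n (int n - j)) \<and>
         card (first_hits w n j) = card (first_hits w n (int n - j))"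
proof (induction n arbitrary: j rule: less_induct)
  case (less n)
  let ?k = "length w"
  define h where "h l = int (ones (take l w))" for l
  have h: "int l = 2 * h l" if "l \<in> border_lengths w" for l
    using bal that unfolding balanced_borders_iff h_def by (metis of_nat_mult of_nat_numeral)
  have k: "?k \<in> border_lengths w" using assms(1) by (rule length_in_border_lengths)
  have hit: "card (first_hits w n j) = card (first_hits w n (int n - j))" for j
  proof (cases "n < ?k")
    case True
    then show ?thesis by (simp add: first_hits_short)
  next
    case False
    define m where "m = n - ?k"
    define R where "R i = (\<Sum>l\<in>border_lengths w - {?k}. card (first_hits w (m + l) (i + h l)))" for i
    have n: "n = m + ?k" "m < n" using False k by (auto simp: m_def border_lengths_def)
    have split: "card (avoiding_ones w m (j - h ?k)) = card (first_hits w n j) + R (j - h ?k)" for j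
      unfolding card_avoiding_ones_eq_sum_first_hits[OF assms(1)] R_def h_def[symmetric]
      by (subst sum.remove[OF _ k]) (auto simp: n)
    \<comment> \<open>Since \<open>w\<close> is a border of itself, \<open>length w\<close> is twice
      \<open>h ?k\<close>; shifting by \<open>h ?k\<close> thus turns reflection at \<open>n\<close>
      into reflection at \<open>m\<close>.\<close>
    have idx: "int n - j - h ?k = int m - (j - h ?k)" using h[OF k] n by simp
    have "R (int n - j - h ?k) = R (j - h ?k)"
      unfolding R_def
    proof (rule sum.cong[OF refl])
      fix l assume l: "l \<in> border_lengths w - {?k}"
      then have "m + l < n" by (auto simp: border_lengths_def n)
      moreover have "int n - j - h ?k + h l = int (m + l) - (j - h ?k + h l)"
        using h[of l] l idx by simp
      ultimately show "card (first_hits w (m + l) (int n - j - h ?k + h l)) =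
          card (first_hits w (m + l) (j - h ?k + h l))"
        using less.IH[of "m + l"] by metis
    qed
    moreover have "card (avoiding_ones w m (int n - j - h ?k)) = card (avoiding_ones w m (j - h ?k))"
      unfolding idx using less.IH[OF n(2)] by metis
    ultimately show ?thesis using split[of j] split[of "int n - j"] by simp
  qed
  have "card (avoiding_ones w n j) = card (avoiding_ones w n (int n - j))"
  proof (cases n)
    case 0
    then show ?thesis by (simp add: avoiding_ones_0[OF assms(1)])
  next
    case (Suc m)
    have s: "card (avoiding_ones w m i) = card (avoiding_ones w m (int m - i))" for i
      using less.IH[of m] Suc by simp
    \<comment> \<open>Replacing \<open>j\<close> by \<open>n - j\<close> exchanges the two terms on
      the right of the one-letter recurrence.\<close>
    have idx: "int m - (j - 1) = int n - j" "int n - j - 1 = int m - j" using Suc by auto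
    have s': "card (avoiding_ones w m (j - 1)) = card (avoiding_ones w m (int n - j))"
      using s[of "j - 1"] unfolding idx .
    show ?thesis
      using card_avoiding_ones_Suc[OF assms(1), of m j, folded Suc]
        card_avoiding_ones_Suc[OF assms(1), of m "int n - j", folded Suc, unfolded idx]
        hit[of j] s[of j] s' by linarith
  qed
  with hit show ?case by blast
qed

text \<open>In the convolution identity at \<open>n = length w - l\<close> only borders of length at least \<open>l\<close>
  contribute; once the longer ones are balanced, the term of length \<open>l\<close> is a symmetric
  singleton.\<close>

lemma symmetric_imp_balanced:
  assumes "w \<noteq> []"
    and S: "\<And>n j. n \<ge> 1 \<Longrightarrow> card (avoiding_ones w n j) = card (avoiding_ones w n (int n - j))"
    and T: "\<And>n j. n \<ge> 1 \<Longrightarrow> card (first_hits w n j) = card (first_hits w n (int n - j))"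
  shows "balanced_borders w"
  unfolding balanced_borders_iff
proof
  let ?k = "length w"
  define h where "h l = int (ones (take l w))" for l
  have kpos: "?k \<ge> 1" using assms(1) by (cases w) auto
  \<comment> \<open>The only nonempty set of first hits of length \<open>length w\<close> sits at
    index \<open>h ?k\<close>, which must be its own reflection.\<close>
  have k: "2 * h ?k = int ?k"
    using T[OF kpos, of "h ?k"] unfolding first_hits_length[OF assms(1)]
    by (auto simp: h_def split: if_splits)
  fix l assume "l \<in> border_lengths w"
  then have "int l = 2 * h l"
  proof (induction "?k - l" arbitrary: l rule: less_induct)
    case less
    show ?case
    proof (cases "l = ?k")
      case True
      then show ?thesis using k by simp
    next
      case False
      with less.prems have l: "l < ?k" "1 \<le> l" by (auto simp: border_lengths_def)
      define n where "n = ?k - l"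
      have n: "n \<ge> 1" "n + l = ?k" using l by (auto simp: n_def)
      define R where "R i = (\<Sum>m\<in>border_lengths w - {l}. card (first_hits w (n + m) (i + h m)))" for i
      have split: "card (avoiding_ones w n i) = card (first_hits w ?k (i + h l)) + R i" for i
        unfolding card_avoiding_ones_eq_sum_first_hits[OF assms(1)] R_def h_def[symmetric]
        by (subst sum.remove[OF _ less.prems]) (auto simp: n)
      have "R (int n - i) = R i" for i
        unfolding R_def
      proof (rule sum.cong[OF refl])
        fix m assume m: "m \<in> border_lengths w - {l}"
        show "card (first_hits w (n + m) (int n - i + h m)) = card (first_hits w (n + m) (i + h m))"
        proof (cases "m < l")
          case True
          then have "n + m < ?k" using n by simp
          then show ?thesis by (simp add: first_hits_short)
        next
          case False
          with m have "m > l" by auto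
          then have "int m = 2 * h m" using less.hyps[of m] m l by auto
          then have "int n - i + h m = int (n + m) - (i + h m)" by simp
          then show ?thesis using T[of "n + m" "i + h m"] n(1) by (metis trans_le_add1)
        qed
      qed
      then have "card (first_hits w ?k (i + h l)) = card (first_hits w ?k (int n - i + h l))" for i
        using split[of i] split[of "int n - i"] S[OF n(1), of i] by simp
      \<comment> \<open>This choice of \<open>i\<close> makes the left side count
        \<open>{w}\<close>, so the reflected index must be \<open>h ?k\<close> as well.\<close>
      from this[of "h ?k - h l"] have "int n - (h ?k - h l) + h l = h ?k"
        unfolding first_hits_length[OF assms(1)] by (auto simp: h_def split: if_splits)
      then show ?thesis using k n(2) by linarith
    qed
  qed
  then show "l = 2 * ones (take l w)" unfolding h_def by linarith
qed

section \<open>Letter frequency\<close>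

lemma sum_ones_avoiding:
  "(\<Sum>u\<in>avoiding w n. f (ones u)) =
    (\<Sum>j\<le>n. real (card (avoiding_ones w n (int j))) * f j)" for f :: "nat \<Rightarrow> real"
proof -
  have "ones ` avoiding w n \<subseteq> {..n}"
    by (auto simp: avoiding_def count_le_length)
  then have "(\<Sum>u\<in>avoiding w n. f (ones u)) =
      (\<Sum>j\<le>n. real (card {u \<in> avoiding w n. ones u = j}) * f j)"
    by (intro sum_fun_comp) auto
  then show ?thesis by (simp add: avoiding_ones_def)
qed

text \<open>Reflecting \<open>j\<close> to \<open>n - j\<close> turns the total number of ones into
  the total number of zeros, so each is half of all letters, already at finite
  \<open>n\<close>.\<close>

lemma letter_freq_at_balanced:
  assumes "w \<noteq> []" "balanced_borders w" "n \<ge> 1"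
  shows "letter_freq_at w n = 1 / 2"
proof -
  define c where "c j = real (card (avoiding_ones w n (int j)))" for j
  have c: "c (n - j) = c j" if "j \<le> n" for j
    using balanced_imp_symmetric[OF assms(1,2), of n "int j"] that by (simp add: c_def)
  let ?S = "\<Sum>u\<in>avoiding w n. real (ones u)"
  have S: "?S = (\<Sum>j\<le>n. c j * real j)" unfolding c_def by (rule sum_ones_avoiding)
  also have "\<dots> = (\<Sum>j\<le>n. c (n - j) * real (n - j))"
    by (rule sum.reindex_bij_witness[of _ "\<lambda>j. n - j" "\<lambda>j. n - j"]) auto
  also have "\<dots> = (\<Sum>j\<le>n. c j * (real n - real j))"
    by (intro sum.cong) (auto simp: c)
  also have "\<dots> = (\<Sum>j\<le>n. c j) * real n - ?S"
    unfolding S by (simp add: sum_distrib_right sum_subtractf right_diff_distrib)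
  finally have "2 * ?S = (\<Sum>j\<le>n. c j) * real n" by simp
  also have "(\<Sum>j\<le>n. c j) = real (card (avoiding w n))"
    using sum_ones_avoiding[of "\<lambda>_. 1" w n] by (simp add: c_def)
  finally have S_eq: "?S = real (card (avoiding w n)) * real n / 2" by simp
  \<comment> \<open>The denominator does not vanish: \<open>w\<close> is a balanced border of
    itself, so it contains a 1 and the all-zero word avoids it.\<close>
  have "card (avoiding w n) \<noteq> 0"
  proof -
    have "length w = 2 * ones (take (length w) w)"
      using assms(2) length_in_border_lengths[OF assms(1)] unfolding balanced_borders_iff by blast
    then have "ones w \<noteq> 0"
      using assms(1) by (metis length_0_conv mult_0_right order_refl take_all)
    then have "True \<in> set w" by (metis count_notin)
    moreover have "True \<notin> set (replicate n False)" by simp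
    ultimately have "\<not> sublist w (replicate n False)" using set_mono_sublist by blast
    then have "replicate n False \<in> avoiding w n" by (simp add: avoiding_def)
    then show ?thesis by (metis card_0_eq empty_iff finite_avoiding)
  qed
  then show ?thesis
    using assms(3) unfolding letter_freq_at_def S_eq by (simp del: card_0_eq)
qed

lemma letter_freq_balanced:
  assumes "w \<noteq> []" "balanced_borders w"
  shows "letter_freq_at w \<longlonglongrightarrow> 1 / 2" "letter_freq w = 1 / 2"
proof -
  \<comment> \<open>Only eventually: at \<open>n = 0\<close> division by zero gives the value
    0.\<close>
  have "eventually (\<lambda>n. letter_freq_at w n = 1 / 2) sequentially"
    using letter_freq_at_balanced[OF assms] by (auto simp: eventually_sequentially)
  then show "letter_freq_at w \<longlonglongrightarrow> 1 / 2" by (rule tendsto_eventually)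
  then show "letter_freq w = 1 / 2" unfolding letter_freq_def by (rule limI)
qed

text \<open>Cut the word into \<open>m\<close> blocks of length \<open>length w\<close>, each
  different from \<open>w\<close>. This crude bound suffices to make the hitting time almost surely
  finite.\<close>

lemma card_avoiding_mult_le:
  assumes "w \<noteq> []"
  shows "card (avoiding w (length w * m)) \<le> (2 ^ length w - 1) ^ m"
proof (induction m)
  case 0
  then show ?case using assms by (simp add: avoiding_def Collect_conv_if cong: conj_cong)
next
  case (Suc m)
  let ?k = "length w"
  have "avoiding w ?k \<subseteq> {u. length u = ?k} - {w}" by (auto simp: avoiding_def)
  then have "card (avoiding w ?k) \<le> card ({u :: bool list. length u = ?k} - {w})"
    using finite_lists_length_eq[of "UNIV :: bool set" ?k] by (intro card_mono) auto
  also have "\<dots> = 2 ^ ?k - 1"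
    using card_lists_length_eq[of "UNIV :: bool set" ?k] by (subst card_Diff_singleton) auto
  finally have k: "card (avoiding w ?k) \<le> 2 ^ ?k - 1" .
  have "card (avoiding w (?k * Suc m)) \<le> card (avoiding w ?k \<times> avoiding w (?k * m))"
  proof (rule card_inj_on_le)
    show "inj_on (\<lambda>u. (take ?k u, drop ?k u)) (avoiding w (?k * Suc m))"
      by (rule inj_onI) (metis append_take_drop_id prod.inject)
    show "(\<lambda>u. (take ?k u, drop ?k u)) ` avoiding w (?k * Suc m) \<subseteq> avoiding w ?k \<times> avoiding w (?k * m)"
      by (auto simp: avoiding_def dest: sublist_order.order.trans[OF _ sublist_take]
          sublist_order.order.trans[OF _ sublist_drop])
  qed simp
  also have "\<dots> \<le> (2 ^ ?k - 1) * (2 ^ ?k - 1) ^ m"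
    unfolding card_cartesian_product by (intro mult_mono k Suc.IH) auto
  finally show ?case by simp
qed

section \<open>Hitting times in terms of finite words\<close>

definition tosses :: "(nat \<Rightarrow> 'a \<Rightarrow> bool) \<Rightarrow> nat \<Rightarrow> 'a \<Rightarrow> bool list" where
  "tosses X n x = map (\<lambda>s. X s x) [1..<n + 1]"

lemma length_tosses [simp]: "length (tosses X n x) = n"
  by (simp add: tosses_def)

lemma take_tosses: "m \<le> n \<Longrightarrow> take m (tosses X n x) = tosses X m x"
  by (simp add: tosses_def take_map del: upt_Suc)

lemma tosses_0: "tosses X 0 x = []"
  by (simp add: tosses_def)

lemma tosses_Suc: "tosses X (Suc n) x = tosses X n x @ [X (Suc n) x]"
  by (simp add: tosses_def)

lemma ones_tosses: "ones (tosses X n x) = num_ones X n x"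
  by (induction n) (auto simp: tosses_0 tosses_Suc num_ones_def)

lemma num_ones_le: "num_ones X n x \<le> n"
  by (metis ones_tosses length_tosses count_le_length)

text \<open>Links the window inspected by \<open>hitting_time\<close> to the last letters of a
  finite word.\<close>

lemma suffix_tosses_iff:
  "suffix w (tosses X n x) \<longleftrightarrow>
    length w \<le> n \<and> map (\<lambda>s. X s x) [n - length w + 1..<n + 1] = w"
proof -
  have "drop (n - length w) (tosses X n x) = map (\<lambda>s. X s x) [n - length w + 1..<n + 1]"
    by (simp add: tosses_def drop_map del: upt_Suc)
  moreover have "suffix w u \<longleftrightarrow> length w \<le> length u \<and> drop (length u - length w) u = w" for u :: "bool list"
    by (auto simp: suffix_def) (metis append_take_drop_id)
  ultimately show ?thesis by simp
qed

lemma sublist_tosses_iff: "sublist w (tosses X n x) \<longleftrightarrow> (\<exists>m\<le>n. suffix w (tosses X m x))"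
  unfolding sublist_iff_suffix_take by (auto simp: take_tosses)

lemma hitting_time_eq_Inf:
  assumes "w \<noteq> []"
  shows "hitting_time X w x = Inf (enat ` {t. suffix w (tosses X t x)})"
proof -
  have "1 \<le> t" if "length w \<le> t" for t using assms that by (cases w) auto
  then have "{enat t |t. 1 \<le> t \<and> length w \<le> t \<and> map (\<lambda>s. X s x) [t - length w + 1..<t + 1] = w}
    = enat ` {t. suffix w (tosses X t x)}"
    unfolding suffix_tosses_iff by blast
  then show ?thesis unfolding hitting_time_def by simp
qed

text \<open>The infimum of the empty set is \<open>\<infinity>\<close>, so a finite value is an
  attained minimum.\<close>

lemma Inf_enat_image_eq_iff: "Inf (enat ` A) = enat n \<longleftrightarrow> n \<in> A \<and> (\<forall>m<n. m \<notin> A)"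
proof
  assume *: "Inf (enat ` A) = enat n"
  then have "A \<noteq> {}" by (auto simp: Inf_enat_def)
  then have "Inf (enat ` A) \<in> enat ` A" by (auto simp: Inf_enat_def intro: LeastI)
  moreover have "m \<notin> A" if "m < n" for m
    using that * Inf_lower[of "enat m" "enat ` A"] by auto
  ultimately show "n \<in> A \<and> (\<forall>m<n. m \<notin> A)" using * by auto
next
  assume "n \<in> A \<and> (\<forall>m<n. m \<notin> A)"
  then show "Inf (enat ` A) = enat n"
    by (intro antisym Inf_lower Inf_greatest) (auto simp: not_less[symmetric])
qed

text \<open>For \<open>n \<ge> 1\<close>, an occurrence ending before time \<open>n\<close> is one
  among the first \<open>n - 1\<close> tosses, that is, in the \<open>butlast\<close>.\<close>

lemma hitting_time_eq_enat_iff: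
  assumes "w \<noteq> []"
  shows "hitting_time X w x = enat n \<longleftrightarrow>
    suffix w (tosses X n x) \<and> \<not> sublist w (butlast (tosses X n x))"
proof (cases n)
  case 0
  then show ?thesis
    using assms unfolding hitting_time_eq_Inf[OF assms] Inf_enat_image_eq_iff by (simp add: tosses_0)
next
  case (Suc m)
  then show ?thesis
    unfolding hitting_time_eq_Inf[OF assms] Inf_enat_image_eq_iff
    by (simp add: tosses_Suc sublist_tosses_iff less_Suc_eq_le)
qed

lemma hitting_time_first_hits_iff:
  assumes "w \<noteq> []"
  shows "hitting_time X w x = enat n \<and> int (num_ones X n x) = j \<longleftrightarrow>
    tosses X n x \<in> first_hits w n j"
  by (simp add: hitting_time_eq_enat_iff[OF assms] first_hits_def ones_tosses)

lemma hitting_time_pos: "w \<noteq> [] \<Longrightarrow> hitting_time X w x = enat n \<Longrightarrow> n \<ge> 1"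
  by (cases n) (auto simp: hitting_time_eq_enat_iff tosses_0)

lemma hitting_time_infinity:
  assumes "w \<noteq> []" "hitting_time X w x = \<infinity>"
  shows "tosses X n x \<in> avoiding w n"
proof -
  have "{t. suffix w (tosses X t x)} = {}"
    using assms(2) Inf_lower[of "enat t" "enat ` {t. suffix w (tosses X t x)}" for t]
    unfolding hitting_time_eq_Inf[OF assms(1)] by auto
  then show ?thesis by (auto simp: avoiding_def sublist_tosses_iff)
qed

section \<open>Law of the hitting time under fair tosses\<close>

locale fair_coin_tosses = prob_space M for M :: "'a measure" +
  fixes X :: "nat \<Rightarrow> 'a \<Rightarrow> bool"
  assumes indep: "indep_vars (\<lambda>_. count_space UNIV) X {1..}"
    and fair: "\<And>i. i \<ge> 1 \<Longrightarrow>
      distr M (count_space UNIV) (X i) = measure_pmf (bernoulli_pmf (1 / 2))"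
begin

lemma measurable_toss: "i \<ge> 1 \<Longrightarrow> X i \<in> measurable M (count_space UNIV)"
  using indep unfolding indep_vars_def by auto

lemma measurable_tosses [measurable]: "tosses X n \<in> measurable M (count_space UNIV)"
proof (induction n)
  case 0
  then show ?case by (simp add: tosses_0[abs_def])
next
  case (Suc n)
  have "(\<lambda>x. tosses X n x @ [X (Suc n) x]) \<in> measurable M (count_space UNIV)"
    \<comment> \<open>As \<open>bool list\<close> is countable, the value of the first
      \<open>n\<close> tosses may be held fixed.\<close>
    by (rule measurable_compose_countable[OF _ Suc])
      (rule measurable_compose[OF measurable_toss], auto)
  then show ?case by (simp add: tosses_Suc[abs_def])
qed

lemma prob_tosses:
  assumes "length v = n"
  shows "prob {x \<in> space M. tosses X n x = v} = (1 / 2) ^ n"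
proof (cases "n = 0")
  case True
  then show ?thesis using assms by (simp add: tosses_0 prob_space)
next
  case False
  have toss: "prob (X i -` {b} \<inter> space M) = 1 / 2" if "i \<ge> 1" for i b
  proof -
    have "prob (X i -` {b} \<inter> space M) = measure (distr M (count_space UNIV) (X i)) {b}"
      by (subst measure_distr) (use measurable_toss that in auto)
    also have "\<dots> = 1 / 2" unfolding fair[OF that] by (cases b) (auto simp: measure_pmf_single)
    finally show ?thesis .
  qed
  have "tosses X n x = v \<longleftrightarrow> (\<forall>i\<in>{1..n}. X i x = v ! (i - 1))" for x
  proof -
    have "tosses X n x = v \<longleftrightarrow> (\<forall>i<n. X (Suc i) x = v ! i)"
      using assms by (simp add: list_eq_iff_nth_eq tosses_def del: upt_Suc)
    also have "\<dots> \<longleftrightarrow> (\<forall>i\<in>{1..n}. X i x = v ! (i - 1))"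
      unfolding image_Suc_lessThan[symmetric] by auto
    finally show ?thesis .
  qed
  then have "{x \<in> space M. tosses X n x = v} = (\<Inter>i\<in>{1..n}. X i -` {v ! (i - 1)} \<inter> space M)"
    using False by auto
  also have "prob \<dots> = (\<Prod>i\<in>{1..n}. prob (X i -` {v ! (i - 1)} \<inter> space M))"
    by (rule indep_varsD[OF indep]) (use False in auto)
  also have "\<dots> = (1 / 2) ^ n" by (simp add: toss)
  finally show ?thesis .
qed

lemma prob_tosses_in:
  assumes "finite A" "\<And>v. v \<in> A \<Longrightarrow> length v = n"
  shows "prob {x \<in> space M. tosses X n x \<in> A} = real (card A) / 2 ^ n"
proof -
  have "{x \<in> space M. tosses X n x \<in> A} = (\<Union>v\<in>A. {x \<in> space M. tosses X n x = v})" by auto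
  also have "prob \<dots> = (\<Sum>v\<in>A. prob {x \<in> space M. tosses X n x = v})"
    by (rule finite_measure_finite_Union) (use assms in \<open>auto simp: disjoint_family_on_def\<close>)
  also have "\<dots> = real (card A) / 2 ^ n"
    using assms(2) by (simp add: prob_tosses power_one_over)
  finally show ?thesis .
qed

text \<open>The factor \<open>2 ^ n\<close> does not depend on \<open>j\<close>, so symmetry of
  these probabilities is symmetry of the counts.\<close>

lemma prob_hit_eq:
  assumes "w \<noteq> []"
  shows "prob_hit M X w n j = real (card (first_hits w n j)) / 2 ^ n"
proof -
  have "{x \<in> space M. hitting_time X w x = enat n \<and>
      int (num_ones X (the_enat (hitting_time X w x)) x) = j} =
    {x \<in> space M. tosses X n x \<in> first_hits w n j}"
    unfolding hitting_time_first_hits_iff[OF assms, symmetric] by auto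
  then show ?thesis
    unfolding prob_hit_def by (simp add: prob_tosses_in[OF finite_first_hits] length_first_hits)
qed

text \<open>Joining time and number of ones in one variable with countable range makes its law
  determined by point masses.\<close>

definition hit :: "bool list \<Rightarrow> 'a \<Rightarrow> (nat \<times> nat) option" where
  "hit w x = (case hitting_time X w x of enat n \<Rightarrow> Some (n, num_ones X n x) | \<infinity> \<Rightarrow> None)"

lemma hit_eq_Some_iff:
  "w \<noteq> [] \<Longrightarrow> hit w x = Some (n, j) \<longleftrightarrow> tosses X n x \<in> first_hits w n (int j)"
  unfolding hitting_time_first_hits_iff[symmetric] hit_def by (auto split: enat.splits)

text \<open>By countability, preimages of points suffice: a \<open>Some\<close> value is decided by
  finitely many tosses, and \<open>None\<close> is the complement of a countable union of such
  events.\<close>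

lemma measurable_hit:
  assumes "w \<noteq> []"
  shows "hit w \<in> measurable M (count_space UNIV)"
proof -
  have Some: "hit w -` {Some p} \<inter> space M \<in> sets M" for p
  proof -
    have "hit w -` {Some p} \<inter> space M =
      {x \<in> space M. tosses X (fst p) x \<in> first_hits w (fst p) (int (snd p))}"
      by (auto simp: hit_eq_Some_iff[OF assms, symmetric])
    then show ?thesis by simp
  qed
  have "hit w -` {None} \<inter> space M = space M - (\<Union>p. hit w -` {Some p} \<inter> space M)"
  proof (rule set_eqI)
    show "x \<in> hit w -` {None} \<inter> space M \<longleftrightarrow> x \<in> space M - (\<Union>p. hit w -` {Some p} \<inter> space M)" for x
      by (cases "hit w x") auto
  qed
  moreover have "(\<Union>p. hit w -` {Some p} \<inter> space M) \<in> sets M"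
    by (rule sets.countable_UN'') (auto intro: Some)
  ultimately have "hit w -` {None} \<inter> space M \<in> sets M"
    by (metis sets.Diff sets.top)
  then have "hit w -` {p} \<inter> space M \<in> sets M" for p
    using Some by (cases p) auto
  then show ?thesis
    by (subst measurable_count_space_eq_countable) auto
qed

text \<open>If \<open>w\<close> never occurs, the first \<open>length w * m\<close> tosses avoid it
  for every \<open>m\<close>, which has probability at most \<open>q ^ m\<close> with
  \<open>q < 1\<close>.\<close>

lemma AE_hit:
  assumes "w \<noteq> []"
  shows "AE x in M. hit w x \<noteq> None"
proof -
  let ?k = "length w" and ?N = "{x \<in> space M. hit w x = None}"
  define q :: real where "q = (2 ^ ?k - 1) / 2 ^ ?k"
  have N: "?N \<in> sets M"
    using measurable_sets[OF measurable_hit[OF assms], of "{None}"]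
    by (simp add: vimage_def Int_def conj_commute)
  have "prob ?N \<le> q ^ m" for m
  proof -
    have "?N \<subseteq> {x \<in> space M. tosses X (?k * m) x \<in> avoiding w (?k * m)}"
      using hitting_time_infinity[OF assms] by (auto simp: hit_def split: enat.splits)
    then have "prob ?N \<le> prob {x \<in> space M. tosses X (?k * m) x \<in> avoiding w (?k * m)}"
      by (rule finite_measure_mono) simp
    also have "\<dots> = real (card (avoiding w (?k * m))) / 2 ^ (?k * m)"
      by (rule prob_tosses_in) (auto simp: avoiding_def[of w "?k * m"] finite_lists_of_length)
    also have "\<dots> \<le> real ((2 ^ ?k - 1) ^ m) / 2 ^ (?k * m)"
      by (intro divide_right_mono of_nat_mono card_avoiding_mult_le assms) auto
    also have "\<dots> = q ^ m" by (simp add: q_def power_divide power_mult of_nat_diff)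
    finally show ?thesis .
  qed
  moreover have "(\<lambda>m. q ^ m) \<longlonglongrightarrow> 0"
    by (rule LIMSEQ_realpow_zero) (auto simp: q_def field_simps)
  ultimately have "prob ?N \<le> 0" by (intro LIMSEQ_le_const) auto
  then have "prob ?N = 0" by (simp add: measure_le_0_iff)
  then have "emeasure M ?N = 0" by (simp add: emeasure_eq_measure)
  with N show ?thesis by (intro AE_I[of _ _ ?N]) blast+
qed

text \<open>The law of \<open>hit w\<close> is invariant under exchanging zeros and ones, and this exchange turns the
  proportion \<open>q\<close> of ones into \<open>1 - q\<close>.\<close>

lemma mean_prop_hit_balanced:
  assumes "w \<noteq> []" "balanced_borders w"
  shows "mean_prop_hit M X w = 1 / 2"
proof -
  \<comment> \<open>Pairs with \<open>j > n\<close> never arise from \<open>hit\<close>; keeping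
    them fixed makes \<open>flip\<close> an involution on the whole type.\<close>
  define flip :: "(nat \<times> nat) option \<Rightarrow> (nat \<times> nat) option" where
    "flip = map_option (\<lambda>(n, j). (n, if j \<le> n then n - j else j))"
  define q :: "(nat \<times> nat) option \<Rightarrow> real" where
    "q p = (case p of None \<Rightarrow> 0 | Some (n, j) \<Rightarrow> real j / real n)" for p
  note [measurable] = measurable_hit[OF assms(1)]
  let ?D = "distr M (count_space UNIV) (hit w)"
  interpret D: prob_space ?D by (rule prob_space_distr) simp
  have flip_flip: "flip (flip p) = p" for p
    by (cases p) (auto simp: flip_def)
  then have vimage: "flip -` {p} = {flip p}" for p by (auto simp: vimage_def)
  have single: "emeasure ?D {flip p} = emeasure ?D {p}" for p
  proof (cases p)
    case None
    then show ?thesis by (simp add: flip_def)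
  next
    case (Some nj)
    have D: "measure ?D {Some (n, j)} = real (card (first_hits w n (int j))) / 2 ^ n" for n j
    proof -
      have "measure ?D {Some (n, j)} = prob {x \<in> space M. tosses X n x \<in> first_hits w n (int j)}"
        by (subst measure_distr)
          (auto simp: hit_eq_Some_iff[OF assms(1), symmetric] intro!: arg_cong[of _ _ prob])
      then show ?thesis by (simp add: prob_tosses_in[OF finite_first_hits] length_first_hits)
    qed
    obtain n j where p: "p = Some (n, j)" using Some by (cases nj) auto
    have "measure ?D {flip p} = measure ?D {p}"
      using balanced_imp_symmetric[OF assms, of n "int j"]
      by (auto simp: p flip_def D of_nat_diff)
    then show ?thesis by (simp add: D.emeasure_eq_measure)
  qed
  \<comment> \<open>The preimage of a point under the involution is again a point of equal mass, and
    point masses determine a law on a countable type.\<close>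
  have D_flip: "?D = distr ?D (count_space UNIV) flip"
    by (rule measure_eqI_countable[of _ UNIV]) (auto simp: emeasure_distr vimage single)
  have mean: "mean_prop_hit M X w = (LINT x|M. q (hit w x))"
    unfolding mean_prop_hit_def
    by (rule Bochner_Integration.integral_cong)
      (auto simp: q_def hit_def prop_ones_def split: enat.splits)
  also have "\<dots> = (LINT p|?D. q p)" by (simp add: integral_distr)
  also have "\<dots> = (LINT p|distr ?D (count_space UNIV) flip. q p)" using D_flip by simp
  also have "\<dots> = (LINT x|M. q (flip (hit w x)))" by (simp add: integral_distr)
  finally have flipped: "mean_prop_hit M X w = (LINT x|M. q (flip (hit w x)))" .
  have q: "\<bar>q (hit w x)\<bar> \<le> 1" "\<bar>q (flip (hit w x))\<bar> \<le> 1"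
    "hit w x \<noteq> None \<Longrightarrow> q (hit w x) + q (flip (hit w x)) = 1" for x
    using num_ones_le[of X _ x] hitting_time_pos[OF assms(1), of X x]
    by (auto simp: q_def hit_def flip_def divide_le_eq of_nat_diff field_simps split: enat.splits)
  have int: "integrable M (\<lambda>x. q (hit w x))" "integrable M (\<lambda>x. q (flip (hit w x)))"
    by (auto intro!: integrable_const_bound[of _ 1] simp: q)
  have "2 * mean_prop_hit M X w = (LINT x|M. q (hit w x) + q (flip (hit w x)))"
    using mean flipped int by simp
  also have "\<dots> = (LINT x|M. 1)"
    \<comment> \<open>On the null event \<open>hit w x = None\<close> the sum is 0 instead of
      1.\<close>
    by (rule integral_cong_AE) (use AE_hit[OF assms(1)] q(3) in auto)
  also have "\<dots> = 1" by (simp add: prob_space)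
  finally show ?thesis by simp
qed

end

theorem proposition3p3:
  fixes w :: "bool list" and M :: "'a measure" and X :: "nat \<Rightarrow> 'a \<Rightarrow> bool"
  assumes "w \<noteq> []"
    and "prob_space M"
    and "prob_space.indep_vars M (\<lambda>_. count_space UNIV) X {1..}"
    and "\<And>i. i \<ge> 1 \<Longrightarrow> distr M (count_space UNIV) (X i) = measure_pmf (bernoulli_pmf (1/2))"
  shows "(balanced_borders w \<longleftrightarrow>
            (\<forall>n\<ge>1. \<forall>j::nat.
               card (avoiding_ones w n (int j)) = card (avoiding_ones w n (int n - int j)) \<and>
               prob_hit M X w n (int j) = prob_hit M X w n (int n - int j)))
         \<and> (balanced_borders w \<longrightarrow>
              letter_freq_at w \<longlonglongrightarrow> letter_freq w \<and>
              letter_freq w = mean_prop_hit M X w \<and> mean_prop_hit M X w = 1/2)"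
proof -
  interpret fair_coin_tosses M X
    using assms(2-4) by (simp add: fair_coin_tosses_def fair_coin_tosses_axioms_def)
  note hit_eq = prob_hit_eq[OF assms(1)]
  have "balanced_borders w"
    if sym: "\<forall>n\<ge>1. \<forall>j::nat.
      card (avoiding_ones w n (int j)) = card (avoiding_ones w n (int n - int j)) \<and>
      prob_hit M X w n (int j) = prob_hit M X w n (int n - int j)"
  proof (rule symmetric_imp_balanced[OF assms(1)])
    fix n :: nat and j :: int
    assume n: "n \<ge> 1"
    have "card (avoiding_ones w n j) = card (avoiding_ones w n (int n - j)) \<and>
      card (first_hits w n j) = card (first_hits w n (int n - j))"
    \<comment> \<open>The assumption covers natural \<open>j\<close> only; for \<open>j < 0\<close>
      the reflected index exceeds \<open>n\<close> and all counts vanish.\<close>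
    proof (cases "j < 0")
      case True
      then show ?thesis by (simp add: avoiding_ones_empty first_hits_empty)
    next
      case False
      then obtain i where j: "j = int i" by (metis int_nat_eq not_less)
      have "card (avoiding_ones w n j) = card (avoiding_ones w n (int n - j))"
        "prob_hit M X w n j = prob_hit M X w n (int n - j)"
        unfolding j using sym n by blast+
      then show ?thesis by (simp add: hit_eq)
    qed
    then show "card (avoiding_ones w n j) = card (avoiding_ones w n (int n - j))"
      "card (first_hits w n j) = card (first_hits w n (int n - j))" by auto
  qed
  moreover have "prob_hit M X w n (int j) = prob_hit M X w n (int n - int j)"
    "card (avoiding_ones w n (int j)) = card (avoiding_ones w n (int n - int j))"
    if "balanced_borders w" for n j
    unfolding hit_eq using balanced_imp_symmetric[OF assms(1) that, of n "int j"] by auto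
  moreover have "letter_freq_at w \<longlonglongrightarrow> letter_freq w \<and>
      letter_freq w = mean_prop_hit M X w \<and> mean_prop_hit M X w = 1 / 2" if "balanced_borders w"
    using letter_freq_balanced[OF assms(1) that] mean_prop_hit_balanced[OF assms(1) that] by metis
  ultimately show ?thesis by blast
qed

end
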